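(* Let $T$ be a compact domain and let $V\subseteq C(T)$ be an $n$-dimensional linear subspace with basis $v_1,\ldots,v_n$. Let $H=\{h_1,\ldots,h_N\}\subseteq T$ be a set of $N$ distinct points with associated signs $\sigma_1,\ldots,\sigma_N\in\{-1,+1\}$, where $\sigma_k=\sigma(h_k)$. Let $A$ be the real $N\times n$ matrix whose entry in row $k$ and column $i$ is $v_i(h_k)\sigma_k$. Then the following three statements are equivalent: (a) $(H,\sigma)$ is an $H$-set for $V$. (b) There is no $x\in\mathbb{R}^n$ such that the vector $b:=Ax\in\mathbb{R}^N$ is negative in all components. (c) There is a nonzero vector $w\in\mathbb{R}^N$ with all components nonnegative such that $w^TA=0$, i.e. $\sum_{k=1}^N w_k v_i(h_k)\sigma_k=0$ for all $1\le i\le n$.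
   Context: $C(T)$ denotes the space of continuous real-valued functions on $T$. Definition ($H$-set). Let $V\subseteq C(T)$ be a linear subspace. An $H$-set for $V$ consists of a subset $H\subseteq T$ and a sign function $\sigma:H\to\{-1,+1\}$ such that there is no $v\in V$ with $v(h)\sigma(h)<0$ for all $h\in H$. *)

theory Defs
  imports
    Complex_Main
    "HOL-Library.Function_Algebras"
    Jordan_Normal_Form.Matrix
begin

interpretation fun_vs: vector_space
  "(\<lambda>c f x. c * f x) :: real \<Rightarrow> ('a \<Rightarrow> real) \<Rightarrow> 'a \<Rightarrow> real"
  by unfold_locales (auto simp: fun_eq_iff algebra_simps)

text \<open>
  Functions on a set \<open>T\<close> are represented by total functions that vanish outside \<open>T\<close>.
  Two members of \<open>cont_funs T\<close> are therefore equal iff they agree on \<open>T\<close>, so that linear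
  independence, bases and dimension refer to the functions on \<open>T\<close> only.
\<close>

definition cont_funs :: "'a::topological_space set \<Rightarrow> ('a \<Rightarrow> real) set" where
  "cont_funs T = {f. continuous_on T f \<and> (\<forall>x. x \<notin> T \<longrightarrow> f x = 0)}"

lemma subspace_cont_funs: "fun_vs.subspace (cont_funs T)"
  unfolding fun_vs.subspace_def cont_funs_def
  by (auto simp: plus_fun_def zero_fun_def intro!: continuous_intros)

definition is_H_set :: "'a set \<Rightarrow> ('a \<Rightarrow> real) set \<Rightarrow> 'a set \<Rightarrow> ('a \<Rightarrow> real) \<Rightarrow> bool" where
  "is_H_set T V H \<sigma> \<longleftrightarrow>
     H \<subseteq> T \<and> (\<forall>h\<in>H. \<sigma> h \<in> {-1, 1}) \<and> \<not> (\<exists>v\<in>V. \<forall>h\<in>H. v h * \<sigma> h < 0)"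

end

theory Submission
  imports Defs
begin

text \<open>
  Since \<open>V\<close> consists of the combinations of the basis, the sign vectors of its members on \<open>H\<close> are
  the vectors \<open>A x\<close>, which links (a) and (b). The link between (a) and (c) is Gordan's alternative
  for the functionals \<open>u \<mapsto> u (h k) * \<sigma> (h k)\<close> on \<open>V\<close>. The alternative is proved for finitely many
  functionals on any subspace \<open>L\<close>, by induction on their number: when a functional \<open>g\<close> is added,
  the induction hypothesis is used both on \<open>L\<close> and on the kernel of \<open>g\<close> in \<open>L\<close>.
\<close>

text \<open>Each strict inequality survives a small perturbation by continuity at
  \<open>e = 0\<close>, and finitely many survive together. This allows leaving the kernel of a new
  functional without losing the signs of the old ones.\<close>

lemma finite_perturb_neg:
  fixes a b :: "'k \<Rightarrow> real"
  assumes "finite K" and "\<And>k. k \<in> K \<Longrightarrow> a k < 0"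
  shows "\<exists>e>0. \<forall>k\<in>K. a k + e * b k < 0"
proof -
  have "\<forall>\<^sub>F e in at_right 0. a k + e * b k < 0" if "k \<in> K" for k
  proof -
    have "((\<lambda>e. a k + e * b k) \<longlongrightarrow> a k + 0 * b k) (at_right 0)"
      by (intro tendsto_intros)
    then show ?thesis
      using assms(2)[OF that] by (intro order_tendstoD(2)) auto
  qed
  then have "\<forall>\<^sub>F e in at_right 0. \<forall>k\<in>K. a k + e * b k < 0"
    using assms(1) by (simp add: eventually_ball_finite)
  then have "\<forall>\<^sub>F e in at_right 0. 0 < e \<and> (\<forall>k\<in>K. a k + e * b k < 0)"
    by (intro eventually_conj eventually_at_right_less)
  then show ?thesis
    using eventually_happens' trivial_limit_at_right_real by blast
qed

text \<open>Serves twice: it makes the two alternatives incompatible, and it fixes the sign of the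
  factor \<open>c\<close> in the induction step.\<close>

lemma sum_nonneg_mult_neg:
  fixes w a :: "'k \<Rightarrow> real"
  assumes "finite K" and "\<And>k. k \<in> K \<Longrightarrow> 0 \<le> w k" and "\<exists>k\<in>K. w k \<noteq> 0"
    and "\<And>k. k \<in> K \<Longrightarrow> a k < 0"
  shows "(\<Sum>k\<in>K. w k * a k) < 0"
proof -
  obtain j where "j \<in> K" "w j \<noteq> 0"
    using assms(3) by blast
  then have "w j * a j < 0"
    using assms(2,4)[of j] by (simp add: mult_pos_neg)
  moreover have "w k * a k \<le> 0" if "k \<in> K" for k
    using assms(2,4)[OF that] by (simp add: mult_nonneg_nonpos)
  ultimately have "(\<Sum>k\<in>K. w k * a k) < (\<Sum>k\<in>K. 0)"
    using assms(1) \<open>j \<in> K\<close> by (intro sum_strict_mono_ex1) auto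
  then show ?thesis
    by simp
qed

lemma gordan_exists:
  fixes s :: "real \<Rightarrow> 'v::ab_group_add \<Rightarrow> 'v" and f :: "'k \<Rightarrow> 'v \<Rightarrow> real"
  assumes "finite K" and "\<And>k. k \<in> K \<Longrightarrow> Vector_Spaces.linear s (*) (f k)"
    and "vector_space s" and "module.subspace s L"
  shows "(\<exists>x\<in>L. \<forall>k\<in>K. f k x < 0) \<or>
    (\<exists>w. (\<forall>k\<in>K. 0 \<le> w k) \<and> (\<exists>k\<in>K. w k \<noteq> 0) \<and> (\<forall>x\<in>L. (\<Sum>k\<in>K. w k * f k x) = 0))"
  using assms(1,2,4)
proof (induction K arbitrary: L rule: finite_induct)
  case empty
  interpret vector_space s by fact
  show ?case
    using subspace_0[OF empty.prems(2)] by auto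
next
  case (insert j K)
  interpret vector_space s by fact
  have lin: "Vector_Spaces.linear s (*) (f k)" if "k \<in> insert j K" for k
    using insert.prems(1) that by blast
  have add: "f k (x + y) = f k x + f k y" if "k \<in> insert j K" for k x y
    using lin[OF that] by (rule Vector_Spaces.linear.axioms(3)[THEN module_hom.add])
  have scale: "f k (s c x) = c * f k x" if "k \<in> insert j K" for k c x
    using lin[OF that] by (rule Vector_Spaces.linear.axioms(3)[THEN module_hom.scale])
  have zero: "f j 0 = 0"
    using scale[of j 0 0] by simp
  note sub = insert.prems(2)
  have IH: "(\<exists>x\<in>M. \<forall>k\<in>K. f k x < 0) \<or>
    (\<exists>w. (\<forall>k\<in>K. 0 \<le> w k) \<and> (\<exists>k\<in>K. w k \<noteq> 0) \<and> (\<forall>x\<in>M. (\<Sum>k\<in>K. w k * f k x) = 0))"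
    if "subspace M" for M
    using that lin by (intro insert.IH) auto
  \<comment> \<open>The hypothesis on \<open>L\<close> gives either weights or a point
    \<open>x\<close> negative on \<open>K\<close>. Given such an \<open>x\<close>, the kernel of
    \<open>f j\<close> is needed only if \<open>x\<close> is not negative at \<open>j\<close> and
    \<open>f j\<close> is nonzero at some \<open>z\<close> in \<open>L\<close>.\<close>
  consider
      (dependent) w where "\<forall>k\<in>K. 0 \<le> w k" "\<exists>k\<in>K. w k \<noteq> 0"
        "\<forall>x\<in>L. (\<Sum>k\<in>K. w k * f k x) = 0"
    | (null) "\<forall>x\<in>L. f j x = 0"
    | (neg) x where "x \<in> L" "\<forall>k\<in>K. f k x < 0" "f j x < 0"
    | (step) x z where "x \<in> L" "\<forall>k\<in>K. f k x < 0" "0 \<le> f j x" "z \<in> L" "f j z \<noteq> 0"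
    using IH[OF sub] not_le by blast
  then show ?case
  proof cases
    case dependent
    have "(\<Sum>k\<in>insert j K. (w(j := 0)) k * f k x) = (\<Sum>k\<in>K. w k * f k x)" for x
      using insert.hyps by (auto intro!: sum.cong)
    moreover have "\<exists>k\<in>insert j K. (w(j := 0)) k \<noteq> 0"
      using dependent(2) insert.hyps(2) by (metis fun_upd_other insertI2)
    ultimately show ?thesis
      using dependent(1,3) by (intro disjI2 exI[of _ "w(j := 0)"]) auto
  next
    case null
    have "(\<Sum>k\<in>insert j K. ((\<lambda>_. 0)(j := 1)) k * f k x) = f j x" for x
      using insert.hyps by (simp add: sum.neutral)
    then show ?thesis
      using null by (intro disjI2 exI[of _ "(\<lambda>_. 0)(j := 1)"]) auto
  next
    case neg
    then show ?thesis by blast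
  next
    case step
    have ker: "subspace {u \<in> L. f j u = 0}"
      using sub add[of j] scale[of j] zero by (auto simp: subspace_def)
    show ?thesis
      using IH[OF ker]
    proof
      assume "\<exists>u\<in>{u \<in> L. f j u = 0}. \<forall>k\<in>K. f k u < 0"
      then obtain u where u: "u \<in> L" "f j u = 0" "\<forall>k\<in>K. f k u < 0"
        by blast
      \<comment> \<open>The point \<open>u\<close> is only zero at \<open>j\<close>. The vector
        \<open>y\<close> is scaled to have value -1 there, so adding a small multiple of it makes
        \<open>j\<close> negative and keeps \<open>K\<close> negative.\<close>
      define t where "t = - 1 / f j z"
      define y where "y = s t z"
      have y: "y \<in> L" "f j y = - 1"
        using step sub by (simp_all add: y_def scale subspace_scale) (simp add: t_def)
      obtain e where e: "e > 0" "\<forall>k\<in>K. f k u + e * f k y < 0"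
        using finite_perturb_neg[of K "\<lambda>k. f k u" "\<lambda>k. f k y"] insert.hyps u by blast
      have "u + s e y \<in> L"
        using u y sub by (simp add: subspace_add subspace_scale)
      moreover have "\<forall>k\<in>insert j K. f k (u + s e y) < 0"
        using e u y by (auto simp: add scale)
      ultimately show ?thesis by blast
    next
      assume "\<exists>w. (\<forall>k\<in>K. 0 \<le> w k) \<and> (\<exists>k\<in>K. w k \<noteq> 0) \<and>
        (\<forall>x\<in>{u \<in> L. f j u = 0}. (\<Sum>k\<in>K. w k * f k x) = 0)"
      then obtain w where w: "\<forall>k\<in>K. 0 \<le> w k" "\<exists>k\<in>K. w k \<noteq> 0"
        and w0: "\<And>u. u \<in> L \<Longrightarrow> f j u = 0 \<Longrightarrow> (\<Sum>k\<in>K. w k * f k u) = 0"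
        by blast
      \<comment> \<open>The only possible factor, read off at \<open>z\<close>, where
        \<open>f j\<close> is nonzero.\<close>
      define c where "c = (\<Sum>k\<in>K. w k * f k z) / f j z"
      \<comment> \<open>The combination vanishes on the kernel of \<open>f j\<close>, hence is a multiple of \<open>f j\<close>;
        the point \<open>x\<close> shows that the factor is negative.\<close>
      have c: "(\<Sum>k\<in>K. w k * f k u) = c * f j u" if "u \<in> L" for u
      proof -
        \<comment> \<open>Chosen to move \<open>u\<close> along \<open>z\<close> into the kernel of
          \<open>f j\<close>, where \<open>w0\<close> applies.\<close>
        define t where "t = - (f j u / f j z)"
        have "u + s t z \<in> L"
          using that step sub by (simp add: subspace_add subspace_scale)
        moreover have "f j (u + s t z) = 0"
          using step by (simp add: add scale) (simp add: t_def)
        ultimately have "0 = (\<Sum>k\<in>K. w k * f k (u + s t z))"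
          using w0 by simp
        also have "\<dots> = (\<Sum>k\<in>K. w k * f k u + t * (w k * f k z))"
          by (intro sum.cong refl) (simp add: add scale algebra_simps)
        also have "\<dots> = (\<Sum>k\<in>K. w k * f k u) + t * (\<Sum>k\<in>K. w k * f k z)"
          by (simp only: sum.distrib sum_distrib_left)
        finally show ?thesis
          by (simp add: c_def t_def)
      qed
      have "c * f j x < 0"
        using c[OF step(1)] sum_nonneg_mult_neg[of K w "\<lambda>k. f k x"] insert.hyps w step by simp
      then have "c < 0"
        using step(3) by (simp add: mult_less_0_iff)
      \<comment> \<open>The weight \<open>- c\<close> at \<open>j\<close> cancels the multiple
        \<open>c * f j\<close> and is admissible since \<open>c < 0\<close>.\<close>
      have "(\<Sum>k\<in>insert j K. (w(j := - c)) k * f k u) = - c * f j u + (\<Sum>k\<in>K. w k * f k u)" for u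
        using insert.hyps by (auto intro!: sum.cong)
      then show ?thesis
        using w c \<open>c < 0\<close> by (intro disjI2 exI[of _ "w(j := - c)"]) auto
    qed
  qed
qed

text \<open>Both alternatives cannot hold: at a point negative for all functionals, the weighted sum
  would be both zero and negative.\<close>

theorem gordan:
  fixes s :: "real \<Rightarrow> 'v::ab_group_add \<Rightarrow> 'v" and f :: "'k \<Rightarrow> 'v \<Rightarrow> real"
  assumes "finite K" and "\<And>k. k \<in> K \<Longrightarrow> Vector_Spaces.linear s (*) (f k)"
    and "vector_space s" and "module.subspace s L"
  shows "\<not> (\<exists>x\<in>L. \<forall>k\<in>K. f k x < 0) \<longleftrightarrow>
    (\<exists>w. (\<forall>k\<in>K. 0 \<le> w k) \<and> (\<exists>k\<in>K. w k \<noteq> 0) \<and> (\<forall>x\<in>L. (\<Sum>k\<in>K. w k * f k x) = 0))"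
    (is "\<not> ?P \<longleftrightarrow> ?Q")
proof -
  have "?P \<or> ?Q"
    using assms by (rule gordan_exists)
  moreover have False if ?P ?Q
  proof -
    from that obtain x w where xw: "x \<in> L" "\<forall>k\<in>K. f k x < 0" "\<forall>k\<in>K. 0 \<le> w k"
      "\<exists>k\<in>K. w k \<noteq> 0" "\<forall>x\<in>L. (\<Sum>k\<in>K. w k * f k x) = 0"
      by blast
    then show False
      using sum_nonneg_mult_neg[of K w "\<lambda>k. f k x"] assms(1) by simp
  qed
  ultimately show ?thesis by blast
qed

lemma linear_eval_scaled:
  "Vector_Spaces.linear (\<lambda>c f x. c * f x) (*) (\<lambda>u :: 'a \<Rightarrow> real. u a * c)"
  by unfold_locales (auto simp: algebra_simps)

lemma sum_fun_apply: "(\<Sum>i\<in>I. f i) x = (\<Sum>i\<in>I. f i x)"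
  for f :: "'i \<Rightarrow> 'a \<Rightarrow> real"
  by (induction I rule: infinite_finite_induct) auto

text \<open>Passes from sums over a set of functions to coordinates indexed like the columns of
  \<open>A\<close>; injectivity of \<open>v\<close> permits the reindexing.\<close>

lemma span_image_combinations:
  fixes v :: "nat \<Rightarrow> 'a \<Rightarrow> real"
  assumes "inj_on v {..<n}"
  shows "fun_vs.span (v ` {..<n}) = {\<lambda>a. \<Sum>i<n. x $ i * v i a | x. x \<in> carrier_vec n}"
proof (intro equalityI subsetI)
  fix u assume "u \<in> fun_vs.span (v ` {..<n})"
  then obtain r where "u = (\<Sum>g\<in>v ` {..<n}. (\<lambda>a. r g * g a))"
    by (auto simp: fun_vs.span_finite)
  then have "u = (\<lambda>a. \<Sum>i<n. vec n (\<lambda>i. r (v i)) $ i * v i a)"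
    using assms by (auto simp: fun_eq_iff sum_fun_apply sum.reindex)
  then show "u \<in> {\<lambda>a. \<Sum>i<n. x $ i * v i a | x. x \<in> carrier_vec n}"
    by (auto intro!: exI[of _ "vec n (\<lambda>i. r (v i))"])
next
  fix u assume "u \<in> {\<lambda>a. \<Sum>i<n. x $ i * v i a | x. x \<in> carrier_vec n}"
  then obtain x where "u = (\<Sum>i<n. (\<lambda>a. x $ i * v i a))"
    by (auto simp: fun_eq_iff sum_fun_apply)
  also have "\<dots> \<in> fun_vs.span (v ` {..<n})"
    by (intro fun_vs.span_sum fun_vs.span_scale fun_vs.span_base imageI)
  finally show "u \<in> fun_vs.span (v ` {..<n})" .
qed

theorem theorem2:
  fixes T :: "'a::topological_space set"
    and V :: "('a \<Rightarrow> real) set"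
    and v :: "nat \<Rightarrow> 'a \<Rightarrow> real"
    and h :: "nat \<Rightarrow> 'a"
    and H :: "'a set"
    and \<sigma> :: "'a \<Rightarrow> real"
    and n N :: nat
    and A :: "real mat"
  assumes "compact T"
    and "fun_vs.subspace V" and "V \<subseteq> cont_funs T" and "fun_vs.dim V = n"
    and "inj_on v {..<n}" and "fun_vs.independent (v ` {..<n})" and "fun_vs.span (v ` {..<n}) = V"
    and "inj_on h {..<N}" and "H = h ` {..<N}" and "H \<subseteq> T"
    and "\<And>x. x \<in> H \<Longrightarrow> \<sigma> x \<in> {-1, 1}"
    and "A = mat N n (\<lambda>(k, i). v i (h k) * \<sigma> (h k))"
  shows "(is_H_set T V H \<sigma> \<longleftrightarrow>
            \<not> (\<exists>x\<in>carrier_vec n. \<forall>k<N. (A *\<^sub>v x) $ k < 0))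
       \<and> (\<not> (\<exists>x\<in>carrier_vec n. \<forall>k<N. (A *\<^sub>v x) $ k < 0) \<longleftrightarrow>
            (\<exists>w\<in>carrier_vec N. w \<noteq> 0\<^sub>v N \<and> (\<forall>k<N. 0 \<le> w $ k) \<and> A\<^sup>T *\<^sub>v w = 0\<^sub>v n))"
proof -
  let ?f = "\<lambda>k u. u (h k) * \<sigma> (h k)"
  let ?u = "\<lambda>x a. \<Sum>i<n. x $ i * v i a"
  have V: "V = {?u x | x. x \<in> carrier_vec n}"
    using assms(7) span_image_combinations[OF assms(5)] by simp
  \<comment> \<open>The vector \<open>A x\<close> lists the signed values at the points
    \<open>h k\<close> of the function with coordinates \<open>x\<close>.\<close>
  have Ax: "(A *\<^sub>v x) $ k = ?f k (?u x)" if "x \<in> carrier_vec n" "k < N" for x k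
    using that assms(12)
    by (auto simp: scalar_prod_def lessThan_atLeast0 sum_distrib_left mult_ac intro!: sum.cong)
  \<comment> \<open>Dually, the transpose applied to \<open>w\<close> lists the values of the
    \<open>w\<close>-weighted functional on the basis.\<close>
  have ATw: "(A\<^sup>T *\<^sub>v w) $ i = (\<Sum>k<N. w $ k * ?f k (v i))"
    if "w \<in> carrier_vec N" "i < n" for w i
    using that assms(12) by (auto simp: scalar_prod_def lessThan_atLeast0 mult_ac intro!: sum.cong)
  have a_iff: "is_H_set T V H \<sigma> \<longleftrightarrow> \<not> (\<exists>u\<in>V. \<forall>k<N. ?f k u < 0)"
    using assms(9-11) unfolding is_H_set_def by auto
  have b_iff: "(\<exists>x\<in>carrier_vec n. \<forall>k<N. (A *\<^sub>v x) $ k < 0) \<longleftrightarrow> (\<exists>u\<in>V. \<forall>k<N. ?f k u < 0)"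
    unfolding V using Ax by auto
  \<comment> \<open>A linear functional vanishes on \<open>V\<close> iff it vanishes on the spanning
    functions \<open>v i\<close>; interchanging the two sums expresses this linearity.\<close>
  have annihilate: "(\<forall>u\<in>V. (\<Sum>k<N. w $ k * ?f k u) = 0) \<longleftrightarrow> A\<^sup>T *\<^sub>v w = 0\<^sub>v n"
    if w: "w \<in> carrier_vec N" for w
  proof
    assume *: "\<forall>u\<in>V. (\<Sum>k<N. w $ k * ?f k u) = 0"
    have "v i \<in> V" if "i < n" for i
      using that assms(7) fun_vs.span_base[of "v i" "v ` {..<n}"] by simp
    then show "A\<^sup>T *\<^sub>v w = 0\<^sub>v n"
      using * ATw[OF w] assms(12) by (intro eq_vecI) simp_all
  next
    assume "A\<^sup>T *\<^sub>v w = 0\<^sub>v n"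
    then have *: "(\<Sum>k<N. w $ k * ?f k (v i)) = 0" if "i < n" for i
      using ATw[OF w that] that by simp
    have "(\<Sum>k<N. w $ k * ?f k (?u x)) = (\<Sum>i<n. x $ i * (\<Sum>k<N. w $ k * ?f k (v i)))" for x
      unfolding sum_distrib_left sum_distrib_right
      by (subst sum.swap) (simp add: mult_ac)
    then show "\<forall>u\<in>V. (\<Sum>k<N. w $ k * ?f k u) = 0"
      using * by (auto simp: V)
  qed
  have "\<not> (\<exists>u\<in>V. \<forall>k<N. ?f k u < 0) \<longleftrightarrow>
      (\<exists>w. (\<forall>k<N. 0 \<le> w k) \<and> (\<exists>k<N. w k \<noteq> 0) \<and> (\<forall>u\<in>V. (\<Sum>k<N. w k * ?f k u) = 0))"
    using gordan[of "{..<N}" "\<lambda>c f x. c * f x" ?f V,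
        OF finite_lessThan linear_eval_scaled fun_vs.vector_space_axioms assms(2)]
    by (simp only: Ball_def Bex_def lessThan_iff)
  \<comment> \<open>Weights change from functions to vectors of length \<open>N\<close>. Only
    indices below \<open>N\<close> are ever read, so restriction by \<open>vec N w\<close> loses
    nothing, and values of \<open>w $ k\<close> beyond the length do not matter.\<close>
  also have "\<dots> \<longleftrightarrow> (\<exists>w\<in>carrier_vec N. (\<forall>k<N. 0 \<le> w $ k) \<and> (\<exists>k<N. w $ k \<noteq> 0) \<and>
      (\<forall>u\<in>V. (\<Sum>k<N. w $ k * ?f k u) = 0))" (is "?L \<longleftrightarrow> ?R")
  proof
    assume ?L
    then obtain w where "(\<forall>k<N. 0 \<le> w k) \<and> (\<exists>k<N. w k \<noteq> 0) \<and> (\<forall>u\<in>V. (\<Sum>k<N. w k * ?f k u) = 0)"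
      by blast
    then show ?R
      by (intro bexI[of _ "vec N w"]) auto
  next
    assume ?R
    then obtain w where "(\<forall>k<N. 0 \<le> w $ k) \<and> (\<exists>k<N. w $ k \<noteq> 0) \<and>
      (\<forall>u\<in>V. (\<Sum>k<N. w $ k * ?f k u) = 0)"
      by blast
    then show ?L
      by (intro exI[of _ "\<lambda>k. w $ k"])
  qed
  also have "\<dots> \<longleftrightarrow>
      (\<exists>w\<in>carrier_vec N. w \<noteq> 0\<^sub>v N \<and> (\<forall>k<N. 0 \<le> w $ k) \<and> A\<^sup>T *\<^sub>v w = 0\<^sub>v n)"
  proof (intro bex_cong refl)
    fix w :: "real vec" assume w: "w \<in> carrier_vec N"
    have "(\<exists>k<N. w $ k \<noteq> 0) \<longleftrightarrow> w \<noteq> 0\<^sub>v N"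
      using w by (metis carrier_vecD eq_vecI index_zero_vec)
    then show "((\<forall>k<N. 0 \<le> w $ k) \<and> (\<exists>k<N. w $ k \<noteq> 0) \<and> (\<forall>u\<in>V. (\<Sum>k<N. w $ k * ?f k u) = 0)) \<longleftrightarrow>
      (w \<noteq> 0\<^sub>v N \<and> (\<forall>k<N. 0 \<le> w $ k) \<and> A\<^sup>T *\<^sub>v w = 0\<^sub>v n)"
      using annihilate[OF w] by blast
  qed
  finally show ?thesis
    using a_iff b_iff by blast
qed

end
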